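(* Let $M\subset E^n$ be a helix hypersurface with respect to a fixed unit direction $d$, let $\xi$ be a unit normal vector field on $M$, and let $\alpha: I\subset\mathbb{R}\to M$ be a unit speed curve on $M$ with nonzero curvatures and Frenet frame $\{V_1,\dots,V_n\}$ in $E^n$. If the $n$-th Frenet vector field $V_n$ of $\alpha$ equals $\xi$ or $-\xi$ along $\alpha$, then $\alpha$ is a $V_n$-slant helix with the direction $d$ in $E^n$.
   Context: $E^n$ is $\mathbb{R}^n$ with the standard scalar product $\langle\cdot,\cdot\rangle$. Helix hypersurface: a hypersurface $M\subset\mathbb{R}^n$ is a helix with respect to a fixed unit vector $d\in\mathbb{R}^n$ if the angle between $d$ and the tangent space $T_qM$ is the same for every $q\in M$; equivalently, $\langle d,\xi\rangle$ is constant along $M$, where $\xi$ is a unit normal vector field on $M$. Frenet frame: for a unit speed curve $\alpha: I\to E^n$, the Frenet frame $\{V_1(s),\dots,V_n(s)\}$ is the orthonormal moving frame with $V_1=\alpha'$ satisfying $V_1'=k_1V_2$, $V_i'=-k_{i-1}V_{i-1}+k_iV_{i+1}$ for $2\le i\le n-1$, and $V_n'=-k_{n-1}V_{n-1}$; the functions $k_1,\dots,k_{n-1}$ are the curvatures of $\alpha$, and "nonzero curvatures" means that $k_1,\dots,k_{n-1}$ vanish nowhere. $V_n$-slant helix: a unit speed curve $\alpha$ with nonzero curvatures is a $V_n$-slant helix with direction a fixed unit vector $X$ if $V_n$ makes a constant angle $\varphi\neq\pi/2$ with $X$, i.e. $\langle V_n,X\rangle=\cos\varphi$ along the curve, with $\varphi$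 constant, $\varphi\ne\pi/2$. *)

theory Defs
  imports "HOL-Analysis.Analysis"
begin

text \<open>
  Hypersurfaces are embedded and of class C\<open>\<^sup>1\<close>: locally zero sets of C\<open>\<^sup>1\<close> functions with nowhere
  vanishing gradient \<open>g\<close>.
\<close>

definition hypersurface :: "(real ^ 'n) set \<Rightarrow> bool" where
  "hypersurface M \<longleftrightarrow>
    (\<forall>q\<in>M. \<exists>U (f :: real ^ 'n \<Rightarrow> real) (g :: real ^ 'n \<Rightarrow> real ^ 'n).
       open U \<and> q \<in> U \<and> continuous_on U g \<and>
       (\<forall>x\<in>U. (f has_derivative (\<lambda>v. g x \<bullet> v)) (at x) \<and> g x \<noteq> 0) \<and>
       M \<inter> U = {x\<in>U. f x = 0})"

definition tangent_space :: "(real ^ 'n) set \<Rightarrow> real ^ 'n \<Rightarrow> (real ^ 'n) set" where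
  "tangent_space M q =
    {v. \<exists>(c :: real \<Rightarrow> real ^ 'n) e. e > 0 \<and> (\<forall>t. \<bar>t\<bar> < e \<longrightarrow> c t \<in> M) \<and> c 0 = q \<and>
          (c has_vector_derivative v) (at 0)}"

definition unit_normal_field :: "(real ^ 'n) set \<Rightarrow> (real ^ 'n \<Rightarrow> real ^ 'n) \<Rightarrow> bool" where
  "unit_normal_field M \<xi> \<longleftrightarrow> continuous_on M \<xi> \<and>
    (\<forall>q\<in>M. norm (\<xi> q) = 1 \<and> (\<forall>v\<in>tangent_space M q. \<xi> q \<bullet> v = 0))"

definition vector_angle :: "real ^ 'n \<Rightarrow> real ^ 'n \<Rightarrow> real" where
  "vector_angle u v = arccos (u \<bullet> v / (norm u * norm v))"

text \<open>The least angle between \<open>d\<close> and a nonzero vector of the subspace \<open>T\<close>.\<close>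

definition subspace_angle :: "real ^ 'n \<Rightarrow> (real ^ 'n) set \<Rightarrow> real" where
  "subspace_angle d T = (INF v \<in> T - {0}. vector_angle d v)"

definition helix_hypersurface :: "(real ^ 'n) set \<Rightarrow> real ^ 'n \<Rightarrow> bool" where
  "helix_hypersurface M d \<longleftrightarrow> hypersurface M \<and> norm d = 1 \<and>
    (\<exists>\<theta>. \<forall>q\<in>M. subspace_angle d (tangent_space M q) = \<theta>)"

text \<open>The interval is nondegenerate but may contain its end points, where derivatives are one-sided.\<close>

definition unit_speed_curve :: "real set \<Rightarrow> (real \<Rightarrow> real ^ 'n) \<Rightarrow> bool" where
  "unit_speed_curve I \<alpha> \<longleftrightarrow> is_interval I \<and> interior I \<noteq> {} \<and>
    (\<forall>s\<in>I. \<exists>v. (\<alpha> has_vector_derivative v) (at s within I) \<and> norm v = 1)"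

text \<open>
  Frames \<open>V i\<close> are indexed by \<open>i = 1, \<dots>, n\<close> and curvatures \<open>k i\<close> by \<open>i = 1, \<dots>, n - 1\<close>, where \<open>n\<close> is the
  dimension; other indices are irrelevant. The definition is meant for \<open>n \<ge> 2\<close>.
\<close>

definition frenet_frame ::
  "real set \<Rightarrow> (real \<Rightarrow> real ^ 'n) \<Rightarrow> (nat \<Rightarrow> real \<Rightarrow> real ^ 'n) \<Rightarrow> (nat \<Rightarrow> real \<Rightarrow> real) \<Rightarrow> bool" where
  "frenet_frame I \<alpha> V k \<longleftrightarrow>
    (let n = CARD('n) in
      \<forall>s\<in>I.
        (\<forall>i\<in>{1..n}. \<forall>j\<in>{1..n}. V i s \<bullet> V j s = (if i = j then 1 else 0)) \<and>
        (\<alpha> has_vector_derivative V 1 s) (at s within I) \<and>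
        (V 1 has_vector_derivative k 1 s *\<^sub>R V 2 s) (at s within I) \<and>
        (\<forall>i\<in>{2..n - 1}.
          (V i has_vector_derivative - k (i - 1) s *\<^sub>R V (i - 1) s + k i s *\<^sub>R V (i + 1) s)
            (at s within I)) \<and>
        (V n has_vector_derivative - k (n - 1) s *\<^sub>R V (n - 1) s) (at s within I))"

definition nonzero_curvatures :: "'n::finite itself \<Rightarrow> real set \<Rightarrow> (nat \<Rightarrow> real \<Rightarrow> real) \<Rightarrow> bool" where
  "nonzero_curvatures _ I k \<longleftrightarrow> (\<forall>i\<in>{1..CARD('n) - 1}. \<forall>s\<in>I. k i s \<noteq> 0)"

text \<open>
  The restriction to \<open>0 \<le> \<phi> \<le> pi\<close> makes \<open>\<phi>\<close> the angle between the two unit vectors; without it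
  \<open>\<phi> \<noteq> pi / 2\<close> would not exclude \<open>cos \<phi> = 0\<close>.
\<close>

definition Vn_slant_helix ::
  "real set \<Rightarrow> (real \<Rightarrow> real ^ 'n) \<Rightarrow> (nat \<Rightarrow> real \<Rightarrow> real ^ 'n) \<Rightarrow> (nat \<Rightarrow> real \<Rightarrow> real)
    \<Rightarrow> real ^ 'n \<Rightarrow> bool" where
  "Vn_slant_helix I \<alpha> V k X \<longleftrightarrow>
    unit_speed_curve I \<alpha> \<and> frenet_frame I \<alpha> V k \<and> nonzero_curvatures TYPE('n) I k \<and> norm X = 1 \<and>
    (\<exists>\<phi>. 0 \<le> \<phi> \<and> \<phi> \<le> pi \<and> \<phi> \<noteq> pi / 2 \<and> (\<forall>s\<in>I. V CARD('n) s \<bullet> X = cos \<phi>))"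

end

theory Submission
  imports Defs
begin

text \<open>
  The unit normal determines the tangent space as its orthogonal complement, and the angle between
  \<open>d\<close> and that complement is \<open>arccos (sqrt (1 - (d \<bullet> \<xi>)\<^sup>2))\<close>. Hence \<open>\<bar>d \<bullet> \<xi>\<bar>\<close> is constant
  on the hypersurface, and by continuity and connectedness so is \<open>d \<bullet> V\<^sub>n\<close> along the curve, whatever
  the signs in \<open>V\<^sub>n = \<plusminus>\<xi>\<close>. If that constant were zero, differentiating \<open>d \<bullet> V\<^sub>n = 0\<close> repeatedly by
  the Frenet equations with nonzero curvatures would make \<open>d\<close> orthogonal to the whole frame.
\<close>

section \<open>Tangent spaces of a hypersurface\<close>

text \<open>
  Only the velocity at \<open>0\<close> matters for a tangent vector, so no implicit function theorem is needed:
  moving \<open>q + t v\<close> along the gradient by at most \<open>\<bar>t\<bar>\<close> reaches a zero of \<open>f\<close> by the intermediate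
  value theorem, and any such displacement is automatically \<open>o(t)\<close>.
\<close>

lemma level_set_tangent_vector:
  fixes f :: "real ^ 'n \<Rightarrow> real"
  assumes U: "open U" "q \<in> U" and cont: "continuous_on U f"
    and der: "(f has_derivative (\<lambda>v. g \<bullet> v)) (at q)" and g0: "g \<noteq> 0" and fq: "f q = 0"
    and M: "{x\<in>U. f x = 0} \<subseteq> M" and v: "g \<bullet> v = 0"
  shows "v \<in> tangent_space M q"
proof -
  define N where "N = g /\<^sub>R norm g"
  have nN: "norm N = 1" and gN: "g \<bullet> N = norm g"
    using g0 by (auto simp: N_def dot_square_norm power2_eq_square)
  define K where "K = norm v + 1"
  have K: "K > 0" by (simp add: K_def add_nonneg_pos)
  have bound: "norm (t *\<^sub>R v + y *\<^sub>R N) \<le> K * \<bar>t\<bar>" if "\<bar>y\<bar> \<le> \<bar>t\<bar>" for t y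
    using norm_triangle_ineq[of "t *\<^sub>R v" "y *\<^sub>R N"] that nN
    by (simp add: K_def algebra_simps)
  \<comment> \<open>Since \<open>g\<close> is orthogonal to \<open>v\<close>, the linear part of
    \<open>f\<close> at the displacement \<open>t *\<^sub>R v + y *\<^sub>R N\<close> is
    \<open>y * norm g\<close>. Tolerance \<open>e / K\<close> in the derivative makes the error at
    most \<open>e * \<bar>t\<bar>\<close>, uniformly in \<open>y\<close>.\<close>
  have approx: "\<exists>\<delta>>0. \<forall>t y. \<bar>t\<bar> < \<delta> \<longrightarrow> \<bar>y\<bar> \<le> \<bar>t\<bar> \<longrightarrow>
      \<bar>f (q + t *\<^sub>R v + y *\<^sub>R N) - y * norm g\<bar> \<le> e * \<bar>t\<bar>" if e: "e > 0" for e
  proof -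
    from der e K obtain d where d: "d > 0"
      "\<And>x. norm (x - q) < d \<Longrightarrow> norm (f x - f q - g \<bullet> (x - q)) \<le> e / K * norm (x - q)"
      unfolding has_derivative_at_alt by (meson divide_pos_pos)
    show ?thesis
    proof (intro exI[of _ "d / K"] conjI allI impI)
      show "d / K > 0" using d K by simp
      fix t y :: real assume t: "\<bar>t\<bar> < d / K" and y: "\<bar>y\<bar> \<le> \<bar>t\<bar>"
      let ?w = "t *\<^sub>R v + y *\<^sub>R N"
      have w: "norm ?w \<le> K * \<bar>t\<bar>" using bound[OF y] .
      have "K * \<bar>t\<bar> < d" using t K by (simp add: field_simps)
      with w have "norm ?w < d" by linarith
      then have "\<bar>f (q + ?w) - g \<bullet> ?w\<bar> \<le> e / K * norm ?w"
        using d(2)[of "q + ?w"] fq by simp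
      also have "\<dots> \<le> e / K * (K * \<bar>t\<bar>)"
        using w e K by (intro mult_left_mono) auto
      finally show "\<bar>f (q + t *\<^sub>R v + y *\<^sub>R N) - y * norm g\<bar> \<le> e * \<bar>t\<bar>"
        using K v gN by (simp add: inner_add_right add.assoc)
    qed
  qed
  obtain r where r: "r > 0" "ball q r \<subseteq> U"
    using U by (meson open_contains_ball)
  \<comment> \<open>With error at most \<open>norm g * \<bar>t\<bar>\<close>, the linear term at
    \<open>y = - \<bar>t\<bar>\<close> and \<open>y = \<bar>t\<bar>\<close> decides the sign of
    \<open>f\<close>, as the intermediate value theorem requires.\<close>
  obtain \<delta> where \<delta>: "\<delta> > 0" "\<And>t y. \<bar>t\<bar> < \<delta> \<Longrightarrow> \<bar>y\<bar> \<le> \<bar>t\<bar> \<Longrightarrow>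
      \<bar>f (q + t *\<^sub>R v + y *\<^sub>R N) - y * norm g\<bar> \<le> norm g * \<bar>t\<bar>"
    using approx[of "norm g"] g0 by auto
  define e where "e = min \<delta> (r / K)"
  have e: "e > 0" using \<delta> r K by (simp add: e_def)
  have inU: "q + t *\<^sub>R v + y *\<^sub>R N \<in> U" if "\<bar>t\<bar> < e" "\<bar>y\<bar> \<le> \<bar>t\<bar>" for t y
  proof -
    have "K * \<bar>t\<bar> < r" using that K by (simp add: e_def field_simps)
    with bound[OF that(2)] have "norm (t *\<^sub>R v + y *\<^sub>R N) < r" by linarith
    then have "q + (t *\<^sub>R v + y *\<^sub>R N) \<in> ball q r"
      by (metis add_diff_cancel_left' dist_commute dist_norm mem_ball)
    then show ?thesis using r by (auto simp: add.assoc)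
  qed
  have "\<exists>y. \<bar>y\<bar> \<le> \<bar>t\<bar> \<and> f (q + t *\<^sub>R v + y *\<^sub>R N) = 0" if t: "\<bar>t\<bar> < e" for t
  proof -
    let ?h = "\<lambda>y. f (q + t *\<^sub>R v + y *\<^sub>R N)"
    have "continuous_on {- \<bar>t\<bar>..\<bar>t\<bar>} ?h"
      by (rule continuous_on_compose2[OF cont]) (auto intro!: continuous_intros inU t)
    moreover have "?h (- \<bar>t\<bar>) \<le> 0"
      using abs_le_D1[OF \<delta>(2)[of t "- \<bar>t\<bar>"]] t by (simp add: e_def mult.commute)
    moreover have "0 \<le> ?h \<bar>t\<bar>"
      using abs_le_D2[OF \<delta>(2)[of t "\<bar>t\<bar>"]] t by (simp add: e_def mult.commute)
    ultimately obtain y where "- \<bar>t\<bar> \<le> y" "y \<le> \<bar>t\<bar>" "?h y = 0"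
      using IVT'[of ?h "- \<bar>t\<bar>" 0 "\<bar>t\<bar>"] by auto
    then show ?thesis by (intro exI[of _ y]) auto
  qed
  then obtain Y where Y: "\<And>t. \<bar>t\<bar> < e \<Longrightarrow> \<bar>Y t\<bar> \<le> \<bar>t\<bar>"
    "\<And>t. \<bar>t\<bar> < e \<Longrightarrow> f (q + t *\<^sub>R v + Y t *\<^sub>R N) = 0"
    by metis
  define c where "c t = q + t *\<^sub>R v + Y t *\<^sub>R N" for t
  have Y0: "Y 0 = 0" using Y(1)[of 0] e by simp
  have "c t \<in> M" if "\<bar>t\<bar> < e" for t
    using inU[OF that Y(1)[OF that]] Y(2)[OF that] M by (auto simp: c_def)
  \<comment> \<open>\<open>Y\<close> is chosen pointwise and need not be continuous. Since
    \<open>f\<close> vanishes at \<open>c t\<close>, \<open>approx\<close> with tolerance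
    \<open>\<epsilon> * norm g\<close> bounds \<open>Y t\<close> itself by
    \<open>\<epsilon> * \<bar>t\<bar>\<close>.\<close>
  moreover have "(c has_vector_derivative v) (at 0)"
    unfolding has_vector_derivative_def has_derivative_at_alt
  proof (intro conjI allI impI)
    show "bounded_linear (\<lambda>x. x *\<^sub>R v)" by (rule bounded_linear_scaleR_left)
    fix \<epsilon> :: real assume \<epsilon>: "\<epsilon> > 0"
    then obtain b where b: "b > 0" "\<And>t y. \<bar>t\<bar> < b \<Longrightarrow> \<bar>y\<bar> \<le> \<bar>t\<bar> \<Longrightarrow>
      \<bar>f (q + t *\<^sub>R v + y *\<^sub>R N) - y * norm g\<bar> \<le> \<epsilon> * norm g * \<bar>t\<bar>"
      using approx[of "\<epsilon> * norm g"] g0 by auto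
    have "norm (c t - c 0 - (t - 0) *\<^sub>R v) \<le> \<epsilon> * norm (t - 0)"
      if t: "norm (t - 0) < min b e" for t
    proof -
      have "\<bar>Y t\<bar> * norm g \<le> \<epsilon> * \<bar>t\<bar> * norm g"
        using b(2)[of t "Y t"] Y[of t] t by (simp add: abs_mult mult_ac)
      then show ?thesis using g0 nN Y0 by (simp add: c_def)
    qed
    then show "\<exists>d>0. \<forall>t. norm (t - 0) < d \<longrightarrow>
        norm (c t - c 0 - (t - 0) *\<^sub>R v) \<le> \<epsilon> * norm (t - 0)"
      using b e by (intro exI[of _ "min b e"]) auto
  qed
  moreover have "c 0 = q" using Y0 by (simp add: c_def)
  ultimately show ?thesis
    unfolding tangent_space_def using e
    by (intro CollectI exI[of _ c] exI[of _ e] conjI allI impI) simp_all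
qed

text \<open>Every vector orthogonal to the gradient is tangent, so \<xi> is orthogonal to all of
  these and must be a nonzero multiple of the gradient; the two complements then agree.\<close>

lemma tangent_space_eq_normal_complement:
  fixes M :: "(real ^ 'n) set"
  assumes M: "hypersurface M" and \<xi>: "unit_normal_field M \<xi>" and q: "q \<in> M"
  shows "tangent_space M q = {v. \<xi> q \<bullet> v = 0}"
proof -
  obtain U and f :: "real ^ 'n \<Rightarrow> real" and G where U: "open U" "q \<in> U"
    and "\<forall>x\<in>U. (f has_derivative (\<lambda>v. G x \<bullet> v)) (at x) \<and> G x \<noteq> 0"
    and MU: "M \<inter> U = {x\<in>U. f x = 0}"
    using bspec[OF M[unfolded hypersurface_def] q] by (elim exE conjE) (rule that)
  then have der: "(f has_derivative (\<lambda>v. G x \<bullet> v)) (at x)" and G0: "G x \<noteq> 0"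
    if "x \<in> U" for x using that by simp_all
  let ?g = "G q"
  have "continuous_on U f"
    using der has_derivative_continuous continuous_at_imp_continuous_on by blast
  then have sub: "v \<in> tangent_space M q" if "?g \<bullet> v = 0" for v
    using level_set_tangent_vector[of U q f ?g M v] U der G0 MU q that by auto
  have n: "norm (\<xi> q) = 1" and orth: "\<And>v. v \<in> tangent_space M q \<Longrightarrow> \<xi> q \<bullet> v = 0"
    using \<xi> q by (auto simp: unit_normal_field_def)
  \<comment> \<open>\<open>a *\<^sub>R ?g\<close> is the projection of \<xi> onto the gradient. The
    remainder \<open>?w\<close> is tangent, hence orthogonal to both \<xi> and \<open>?g\<close>,
    hence to itself.\<close>
  define a where "a = (\<xi> q \<bullet> ?g) / (?g \<bullet> ?g)"
  let ?w = "\<xi> q - a *\<^sub>R ?g"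
  have gw: "?g \<bullet> ?w = 0"
    using G0[OF U(2)] by (simp add: a_def inner_diff_right inner_commute)
  then have "\<xi> q \<bullet> ?w = 0" using orth sub by blast
  with gw have "?w \<bullet> ?w = 0" by (simp add: inner_diff_left)
  then have \<xi>g: "\<xi> q = a *\<^sub>R ?g" by simp
  then have "a \<noteq> 0" using n by auto
  then show ?thesis using sub orth by (auto simp: \<xi>g)
qed

section \<open>The helix angle in terms of the normal\<close>

text \<open>On the hyperplane, \<open>d\<close> and its projection \<open>p\<close> have the same
  inner products, so by Cauchy-Schwarz the cosine of the angle is at most \<open>norm p\<close>,
  with equality in the direction of \<open>p\<close>.\<close>

lemma subspace_angle_normal_complement:
  fixes d \<xi> :: "real ^ 'n"
  assumes n: "CARD('n) \<ge> 2" and d: "norm d = 1" and \<xi>: "norm \<xi> = 1"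
  shows "subspace_angle d {v. \<xi> \<bullet> v = 0} = arccos (sqrt (1 - (d \<bullet> \<xi>)\<^sup>2))"
proof -
  define p where "p = d - (d \<bullet> \<xi>) *\<^sub>R \<xi>"
  have dd: "d \<bullet> d = 1" and xx: "\<xi> \<bullet> \<xi> = 1" using d \<xi> by (auto simp: dot_square_norm)
  have \<xi>p: "\<xi> \<bullet> p = 0" by (simp add: p_def inner_diff_right xx inner_commute)
  have dp: "d \<bullet> v = p \<bullet> v" if "\<xi> \<bullet> v = 0" for v
    using that by (simp add: p_def inner_diff_left)
  have np: "norm p = sqrt (1 - (d \<bullet> \<xi>)\<^sup>2)"
    unfolding norm_eq_sqrt_inner dp[OF \<xi>p, symmetric]
    by (simp add: p_def inner_diff_right dd power2_eq_square)
  have np1: "norm p \<le> 1" unfolding np by simp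
  \<comment> \<open>\<open>u\<close> attains the least angle. If \<open>p = 0\<close>, then
    \<open>d\<close> is normal to the hyperplane and any nonzero vector in it will do; dimension at
    least 2 provides one.\<close>
  obtain u where u: "u \<noteq> 0" "\<xi> \<bullet> u = 0" "d \<bullet> u = norm p * norm u"
  proof (cases "p = 0")
    case True
    obtain u where "u \<noteq> 0" "orthogonal \<xi> u"
      by (rule orthogonal_to_vector_exists[of \<xi>]) (use n in auto)
    then show ?thesis using that[of u] dp[of u] True by (simp add: orthogonal_def)
  next
    case False
    then show ?thesis using that[of p] \<xi>p dp[OF \<xi>p]
      by (simp add: dot_square_norm power2_eq_square)
  qed
  show ?thesis
    unfolding subspace_angle_def np[symmetric]
  proof (rule cInf_eq_minimum)
    have "vector_angle d u = arccos (norm p)"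
      using u d by (simp add: vector_angle_def)
    then show "arccos (norm p) \<in> vector_angle d ` ({v. \<xi> \<bullet> v = 0} - {0})"
      using u by (intro image_eqI[of _ _ u]) auto
  next
    fix x assume "x \<in> vector_angle d ` ({v. \<xi> \<bullet> v = 0} - {0})"
    then obtain v where v: "v \<noteq> 0" "\<xi> \<bullet> v = 0" "x = arccos (d \<bullet> v / norm v)"
      using d by (auto simp: vector_angle_def)
    have "d \<bullet> v / norm v \<le> norm p"
      using v norm_cauchy_schwarz[of p v] by (simp add: dp field_simps)
    moreover have "- 1 \<le> d \<bullet> v / norm v"
      using v d Cauchy_Schwarz_ineq2[of d v] by (simp add: field_simps)
    ultimately show "arccos (norm p) \<le> x"
      using np1 v(3) by (simp add: arccos_le_arccos)
  qed
qed

text \<open>\<open>arccos\<close> is injective on [-1, 1], so the constant angle determines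
  \<open>(d \<bullet> \<xi> q)\<^sup>2\<close>, and thus the inner product up to sign.\<close>

lemma helix_hypersurface_inner_normal:
  fixes M :: "(real ^ 'n) set"
  assumes n: "CARD('n) \<ge> 2" and M: "helix_hypersurface M d" and \<xi>: "unit_normal_field M \<xi>"
    and q: "p \<in> M" "q \<in> M"
  shows "\<bar>d \<bullet> \<xi> p\<bar> = \<bar>d \<bullet> \<xi> q\<bar>"
proof -
  have d: "norm d = 1" and hyp: "hypersurface M"
    using M by (auto simp: helix_hypersurface_def)
  have u: "norm (\<xi> x) = 1" if "x \<in> M" for x
    using \<xi> that by (simp add: unit_normal_field_def)
  have ang: "subspace_angle d (tangent_space M x) = arccos (sqrt (1 - (d \<bullet> \<xi> x)\<^sup>2))"
    if "x \<in> M" for x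
    using tangent_space_eq_normal_complement[OF hyp \<xi> that]
      subspace_angle_normal_complement[OF n d u[OF that]] by simp
  have le: "(d \<bullet> \<xi> x)\<^sup>2 \<le> 1" if "x \<in> M" for x
    using Cauchy_Schwarz_ineq2[of d "\<xi> x"] d u[OF that] by (simp add: abs_square_le_1)
  have "arccos (sqrt (1 - (d \<bullet> \<xi> p)\<^sup>2)) = arccos (sqrt (1 - (d \<bullet> \<xi> q)\<^sup>2))"
    using M q ang by (metis helix_hypersurface_def)
  then have "sqrt (1 - (d \<bullet> \<xi> p)\<^sup>2) = sqrt (1 - (d \<bullet> \<xi> q)\<^sup>2)"
    using le q by (subst (asm) arccos_eq_iff) (auto intro!: order.trans[of "-1" 0] simp: abs_le_iff)
  then show ?thesis by (simp add: power2_eq_iff abs_eq_iff)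
qed

text \<open>The range lies in the finite set \<open>{a, - a}\<close>. This removes the sign
  ambiguity along the curve.\<close>

lemma constant_on_connected_if_abs_constant:
  fixes h :: "'a::topological_space \<Rightarrow> real"
  assumes "connected S" "continuous_on S h" "\<And>x. x \<in> S \<Longrightarrow> \<bar>h x\<bar> = a"
  shows "h constant_on S"
proof (rule continuous_finite_range_constant[OF assms(1,2)])
  have "h ` S \<subseteq> {a, - a}" using assms(3) by fastforce
  then show "finite (h ` S)" by (rule finite_subset) simp
qed

section \<open>Vectors orthogonal to a Frenet frame\<close>

lemma orthonormal_family_inner_zero:
  fixes B :: "nat \<Rightarrow> real ^ 'n"
  assumes on: "\<forall>i\<in>{1..CARD('n)}. \<forall>j\<in>{1..CARD('n)}. B i \<bullet> B j = (if i = j then 1 else 0)"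
    and z: "\<And>i. i \<in> {1..CARD('n)} \<Longrightarrow> B i \<bullet> d = 0"
  shows "d = 0"
proof -
  let ?S = "B ` {1..CARD('n)}"
  \<comment> \<open>Injectivity gives the image exactly \<open>CARD('n)\<close> elements, so as an
    independent set it spans the space.\<close>
  have inj: "inj_on B {1..CARD('n)}"
  proof (rule inj_onI)
    fix i j assume ij: "i \<in> {1..CARD('n)}" "j \<in> {1..CARD('n)}" "B i = B j"
    have "B i \<bullet> B i = 1" using on ij(1) by simp
    moreover have "B i \<bullet> B j = (if i = j then 1 else 0)" using on ij(1,2) by blast
    ultimately show "i = j" using ij(3) by (metis zero_neq_one)
  qed
  have ne: "0 \<notin> ?S" using on by (metis (no_types, lifting) imageE inner_zero_left zero_neq_one)
  have "pairwise orthogonal ?S"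
    using on by (auto simp: pairwise_def orthogonal_def)
  then have "independent ?S" using ne pairwise_orthogonal_independent by blast
  moreover have "dim (UNIV :: (real ^ 'n) set) = card ?S" using card_image[OF inj] by simp
  ultimately have "d \<in> span ?S"
    using card_ge_dim_independent[of ?S UNIV] by auto
  moreover have "orthogonal d x" if "x \<in> ?S" for x
    using that z by (auto simp: orthogonal_def inner_commute)
  ultimately have "orthogonal d d" by (rule orthogonal_to_span)
  then show ?thesis by (simp add: orthogonal_def)
qed

lemma has_vector_derivative_inner_zero:
  fixes F :: "real \<Rightarrow> 'a::real_inner"
  assumes I: "is_interval I" "interior I \<noteq> {}" and s: "s \<in> I"
    and der: "(F has_vector_derivative D) (at s within I)"
    and z: "\<And>x. x \<in> I \<Longrightarrow> F x \<bullet> d = 0"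
  shows "D \<bullet> d = 0"
proof -
  have "((\<lambda>x. F x \<bullet> d) has_vector_derivative D \<bullet> d) (at s within I)"
    using bounded_linear.has_vector_derivative[OF bounded_linear_inner_left der] .
  then have 1: "((\<lambda>x. 0) has_vector_derivative D \<bullet> d) (at s within I)"
    by (rule has_vector_derivative_transform[OF s, rotated]) (simp add: z)
  \<comment> \<open>A second point in the connected set \<open>I\<close> makes \<open>s\<close> a
    limit point of it, end points included, so derivatives within \<open>I\<close> are
    unique.\<close>
  have "\<exists>x. x \<in> I \<and> x \<noteq> s"
  proof (rule ccontr)
    assume "\<not> ?thesis"
    then have "I \<subseteq> {s}" by auto
    then show False using I interior_mono[of I "{s}"] by auto
  qed
  then have "at s within I \<noteq> bot"
    using s I(1) connected_imp_perfect[of I s] unfolding trivial_limit_within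
    by (metis is_interval_connected_1 singletonD)
  then show ?thesis
    using vector_derivative_unique_within[OF _ 1 has_vector_derivative_const] by blast
qed

lemma frenet_frame_orthogonal_imp_zero:
  fixes \<alpha> :: "real \<Rightarrow> real ^ 'n"
  assumes n: "CARD('n) \<ge> 2" and I: "is_interval I" "interior I \<noteq> {}"
    and F: "frenet_frame I \<alpha> V k" and k: "nonzero_curvatures TYPE('n) I k"
    and z: "\<And>s. s \<in> I \<Longrightarrow> V CARD('n) s \<bullet> d = 0"
  shows "d = 0"
proof -
  let ?n = "CARD('n)"
  have Vn: "(V ?n has_vector_derivative - k (?n - 1) s *\<^sub>R V (?n - 1) s) (at s within I)"
    and Vi: "\<And>i. i \<in> {2..?n - 1} \<Longrightarrow> (V i has_vector_derivative
        - k (i - 1) s *\<^sub>R V (i - 1) s + k i s *\<^sub>R V (i + 1) s) (at s within I)"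
    if "s \<in> I" for s
    using F that by (auto simp: frenet_frame_def Let_def)
  have k0: "k i s \<noteq> 0" if "s \<in> I" "1 \<le> i" "i \<le> ?n - 1" for i s
    using k that by (auto simp: nonzero_curvatures_def)
  \<comment> \<open>The equation for the last frame vector contains only \<open>V (?n - 1)\<close>,
    which starts the descent.\<close>
  have pred: "\<forall>s\<in>I. V (?n - 1) s \<bullet> d = 0"
  proof
    fix s assume s: "s \<in> I"
    show "V (?n - 1) s \<bullet> d = 0"
      using has_vector_derivative_inner_zero[OF I s Vn[OF s] z] k0[OF s, of "?n - 1"] n by auto
  qed
  \<comment> \<open>Two neighbouring indices are carried because the derivative of
    \<open>V i\<close> involves \<open>V (i + 1)\<close> and \<open>V (i - 1)\<close>: the former is
    already orthogonal to \<open>d\<close>, and \<open>k (i - 1) s \<noteq> 0\<close> yields the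
    latter. The bound on \<open>j\<close> keeps all indices at least 1.\<close>
  have *: "\<forall>s\<in>I. V (?n - j) s \<bullet> d = 0 \<and> V (?n - Suc j) s \<bullet> d = 0" if "j < ?n - 1" for j
    using that
  proof (induction j)
    case 0
    then show ?case using z pred by simp
  next
    case (Suc j)
    define i where "i = ?n - Suc j"
    have i: "i \<in> {2..?n - 1}" "?n - j = i + 1" "?n - Suc (Suc j) = i - 1"
      using Suc.prems by (auto simp: i_def)
    have IH: "V (i + 1) s \<bullet> d = 0" "V i s \<bullet> d = 0" if "s \<in> I" for s
      using Suc.IH Suc.prems that unfolding i(2) i_def[symmetric] by simp_all
    have "1 \<le> i - 1" "i - 1 \<le> ?n - 1" using i(1) by auto
    then have "V (i - 1) s \<bullet> d = 0" if s: "s \<in> I" for s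
      using has_vector_derivative_inner_zero[OF I s Vi[OF s i(1)] IH(2)] IH(1)[OF s]
        k0[OF s, of "i - 1"] by (auto simp: inner_diff_left inner_add_left)
    then show ?case using IH unfolding i(3) i_def[symmetric] by simp
  qed
  obtain s where s: "s \<in> I" using I by (metis interior_empty ex_in_conv)
  have "V i s \<bullet> d = 0" if "i \<in> {1..?n}" for i
  proof (cases "i = ?n")
    case False
    then have "?n - Suc (?n - Suc i) = i" "?n - Suc i < ?n - 1" using that by auto
    then show ?thesis using *[of "?n - Suc i"] s by auto
  qed (use z s in simp)
  moreover have "\<forall>i\<in>{1..?n}. \<forall>j\<in>{1..?n}. V i s \<bullet> V j s = (if i = j then 1 else 0)"
    using F s unfolding frenet_frame_def Let_def by blast
  ultimately show ?thesis using orthonormal_family_inner_zero[of "\<lambda>i. V i s"] by blast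
qed

section \<open>The slant helix property\<close>

theorem theorem3p2:
  fixes M :: "(real ^ 'n) set" and d :: "real ^ 'n" and \<xi> :: "real ^ 'n \<Rightarrow> real ^ 'n"
    and I :: "real set" and \<alpha> :: "real \<Rightarrow> real ^ 'n"
    and V :: "nat \<Rightarrow> real \<Rightarrow> real ^ 'n" and k :: "nat \<Rightarrow> real \<Rightarrow> real"
  assumes "CARD('n) \<ge> 2"
    and "helix_hypersurface M d"
    and "unit_normal_field M \<xi>"
    and "unit_speed_curve I \<alpha>"
    and "\<alpha> ` I \<subseteq> M"
    and "frenet_frame I \<alpha> V k"
    and "nonzero_curvatures TYPE('n) I k"
    and "\<forall>s\<in>I. V CARD('n) s = \<xi> (\<alpha> s) \<or> V CARD('n) s = - \<xi> (\<alpha> s)"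
  shows "Vn_slant_helix I \<alpha> V k d"
proof -
  let ?n = "CARD('n)" and ?h = "\<lambda>s. V CARD('n) s \<bullet> d"
  have I: "is_interval I" "interior I \<noteq> {}"
    using assms(4) by (auto simp: unit_speed_curve_def)
  have d: "norm d = 1" using assms(2) by (simp add: helix_hypersurface_def)
  obtain s0 where s0: "s0 \<in> I" using I by (metis interior_empty ex_in_conv)
  have abs: "\<bar>?h s\<bar> = \<bar>d \<bullet> \<xi> (\<alpha> s)\<bar>" if "s \<in> I" for s
    using assms(8) that by (metis abs_minus_cancel inner_commute inner_minus_left)
  have "\<bar>?h s\<bar> = \<bar>?h s0\<bar>" if "s \<in> I" for s
    using helix_hypersurface_inner_normal[OF assms(1-3), of "\<alpha> s" "\<alpha> s0"] assms(5) that s0 abs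
    by (metis image_subset_iff)
  \<comment> \<open>Continuity comes from differentiability of the frame, so the sign relating it to
    \<xi> may be chosen separately at each \<open>s\<close>.\<close>
  moreover have "continuous_on I (V ?n)"
    using assms(6) unfolding frenet_frame_def Let_def
    by (meson continuous_on_eq_continuous_within has_vector_derivative_continuous)
  then have "continuous_on I ?h" by (intro continuous_intros)
  ultimately have "?h constant_on I"
    using constant_on_connected_if_abs_constant[of I ?h "\<bar>?h s0\<bar>"] I(1)
    by (simp add: is_interval_connected_1)
  then obtain c where c: "\<And>s. s \<in> I \<Longrightarrow> ?h s = c"
    by (auto simp: constant_on_def)
  have "c \<noteq> 0"
    using frenet_frame_orthogonal_imp_zero[OF assms(1) I assms(6,7), of d] c d by auto
  have "norm (V ?n s0) = 1"
    using assms(6) s0 by (auto simp: frenet_frame_def Let_def norm_eq_1)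
  then have c1: "\<bar>c\<bar> \<le> 1"
    using Cauchy_Schwarz_ineq2[of "V ?n s0" d] c[OF s0] d by simp
  \<comment> \<open>The slant angle is \<open>arccos c\<close>; it lies in [0, pi] and differs from
    \<open>pi / 2\<close> because \<open>c \<noteq> 0\<close>.\<close>
  have "cos (arccos c) = c" using c1 by (simp add: cos_arccos_abs)
  moreover have "arccos c \<noteq> pi / 2" using \<open>c \<noteq> 0\<close> calculation by (metis cos_pi_half)
  moreover have "0 \<le> arccos c" "arccos c \<le> pi"
    using c1 by (auto intro: arccos_lbound arccos_ubound)
  ultimately show ?thesis
    using assms(4,6,7) d c unfolding Vn_slant_helix_def
    by (intro conjI exI[of _ "arccos c"]) auto
qed

end
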